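(* Let $\Omega\subset\mathbb{R}^n$ be an open set. If $g\in L^{p-1}_{sp}(\mathbb{R}^n)$ is bounded from above, then the upper class $\mathcal U_g$ is nonempty.
   Context: Standing assumptions: $n\ge1$ is an integer, $s\in(0,1)$, $p\in(1,\infty)$, $\Lambda\ge1$, and $K:\mathbb{R}^n\times\mathbb{R}^n\to[0,\infty)$ is a measurable symmetric kernel ($K(x,y)=K(y,x)$) with $\Lambda^{-1}\le K(x,y)|x-y|^{n+sp}\le\Lambda$ for a.e. $x,y\in\mathbb{R}^n$. Functions are measurable; $D\Subset\Omega$ means that $\overline D$ is a compact subset of $\Omega$; $u_\pm:=\max\{\pm u,0\}$. $W^{s,p}(U)$ consists of $v\in L^p(U)$ with $\int_U\int_U\frac{|v(x)-v(y)|^p}{|x-y|^{n+sp}}\,dx\,dy<\infty$; $v\in W^{s,p}_{\rm loc}(\Omega)$ means $v\in W^{s,p}(D)$ for every open $D\Subset\Omega$. The tail space is $L^{p-1}_{sp}(\mathbb{R}^n):=\{f\in L^{p-1}_{\rm loc}(\mathbb{R}^n):\int_{\mathbb{R}^n}|f(x)|^{p-1}(1+|x|)^{-n-sp}\,dx<\infty\}$. A weak supersolution in an open set $\Omega$ is a function $u$ on $\mathbb{R}^n$ with $u\in W^{s,p}_{\rm loc}(\Omega)$, $u_-\in L^{p-1}_{sp}(\mathbb{R}^n)$, and $$\int_{\mathbb{R}^n}\int_{\mathbb{R}^n}|u(x)-u(y)|^{p-2}(u(x)-u(y))(\eta(x)-\eta(y))K(x,y)\,dx\,dy\ge0$$ for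 every nonnegative $\eta\in C_0^\infty(\Omega)$. $u$ is a weak subsolution if $-u$ is a weak supersolution, and a weak solution if it is both. "$v\in C(\overline D)$ is a weak solution in $D$" means that $v$, defined on $\mathbb{R}^n$, is a weak solution in $D$ whose restriction to $\overline D$ is continuous (and finite). A function $u:\mathbb{R}^n\to[-\infty,\infty]$ is $(s,p)$-superharmonic in an open set $\Omega$ if: (a) $u<+\infty$ almost everywhere in $\Omega$ and $u>-\infty$ everywhere in $\Omega$; (b) $u$ is lower semicontinuous in $\Omega$; (c) if $D\Subset\Omega$ is open and $v\in C(\overline D)$ is a weak solution in $D$ such that $v_+\in L^\infty(\mathbb{R}^n)$ and $u\ge v$ on $\partial D$ and almost everywhere on $\mathbb{R}^n\setminus D$, then $u\ge v$ in $D$; (d) $u_-\in L^{p-1}_{sp}(\mathbb{R}^n)$. The upper class $\mathcal U_g$ of $g\in L^{p-1}_{sp}(\mathbb{R}^n)$ (relative to $\Omega$) consists of all functions $u$ such that (i) $u$ is $(s,p)$-superharmonic in $\Omega$; (ii) $u$ is bounded from below in $\Omega$; (iii) $\liminf_{\Omega\ni y\to x}u(y)\ge\operatorname{ess\,lim\,sup}_{\mathbb{R}^n\setminus\Omega\ni y\to x}g(y)$ for all $x\in\partial\Omega$; (iv) $u=g$ almost everywhere in $\mathbb{R}^n\setminus\Omega$. *)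

theory Defs
  imports "HOL-Analysis.Analysis" "HOL-Probability.Essential_Supremum"
begin

text \<open>
  Euclidean n-space is a type \<open>'a\<close> of class \<open>euclidean_space\<close>, with n = \<open>DIM('a)\<close>, which is
  at least 1. Measurability is Lebesgue measurability. Double integrals over pairs (x, y) are
  integrals with respect to Lebesgue measure on the type \<open>'a \<times> 'a\<close>, which is again Euclidean.
\<close>

definition admissible_kernel :: "real \<Rightarrow> real \<Rightarrow> real \<Rightarrow> ('a::euclidean_space \<Rightarrow> 'a \<Rightarrow> real) \<Rightarrow> bool" where
  "admissible_kernel s p \<Lambda> K \<longleftrightarrow>
     (\<forall>x y. 0 \<le> K x y) \<and>
     (\<forall>x y. K x y = K y x) \<and>
     (\<lambda>(x, y). K x y) \<in> borel_measurable (lebesgue :: ('a \<times> 'a) measure) \<and>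
     (AE (x, y) in (lebesgue :: ('a \<times> 'a) measure).
        1 / \<Lambda> \<le> K x y * norm (x - y) powr (real DIM('a) + s * p) \<and>
        K x y * norm (x - y) powr (real DIM('a) + s * p) \<le> \<Lambda>)"

definition compactly_contained :: "'a::euclidean_space set \<Rightarrow> 'a set \<Rightarrow> bool" (infix "\<Subset>" 50) where
  "D \<Subset> \<Omega> \<longleftrightarrow> compact (closure D) \<and> closure D \<subseteq> \<Omega>"

definition sobolev :: "real \<Rightarrow> real \<Rightarrow> 'a::euclidean_space set \<Rightarrow> ('a \<Rightarrow> real) set" where
  "sobolev s p U = {v. v \<in> borel_measurable (lebesgue_on U) \<and>
     (\<integral>\<^sup>+x\<in>U. ennreal (\<bar>v x\<bar> powr p) \<partial>lebesgue) < \<infinity> \<and>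
     (\<integral>\<^sup>+z\<in>U \<times> U. ennreal (\<bar>v (fst z) - v (snd z)\<bar> powr p /
        norm (fst z - snd z) powr (real DIM('a) + s * p)) \<partial>lebesgue) < \<infinity>}"

definition sobolev_loc :: "real \<Rightarrow> real \<Rightarrow> 'a::euclidean_space set \<Rightarrow> ('a \<Rightarrow> real) set" where
  "sobolev_loc s p \<Omega> = {v. \<forall>D. open D \<and> D \<Subset> \<Omega> \<longrightarrow> v \<in> sobolev s p D}"

text \<open>
  The members of the tail space are extended real valued, so that the space applies both to the
  data \<open>g\<close> and to superharmonic functions. They are finite almost everywhere, as the local
  integrability requires; \<open>real_of_ereal\<close> sends infinite values to 0, but only on a null set.
\<close>

definition tail_space :: "real \<Rightarrow> real \<Rightarrow> ('a::euclidean_space \<Rightarrow> ereal) set" where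
  "tail_space s p = {f. f \<in> borel_measurable lebesgue \<and>
     (AE x in lebesgue. \<bar>f x\<bar> \<noteq> \<infinity>) \<and>
     (\<forall>C. compact C \<longrightarrow>
        (\<integral>\<^sup>+x\<in>C. ennreal (\<bar>real_of_ereal (f x)\<bar> powr (p - 1)) \<partial>lebesgue) < \<infinity>) \<and>
     (\<integral>\<^sup>+x. ennreal (\<bar>real_of_ereal (f x)\<bar> powr (p - 1) *
        (1 + norm x) powr (- real DIM('a) - s * p)) \<partial>lebesgue) < \<infinity>}"

primrec C_k :: "nat \<Rightarrow> ('a::euclidean_space \<Rightarrow> real) \<Rightarrow> bool" where
  "C_k 0 f \<longleftrightarrow> continuous_on UNIV f"
| "C_k (Suc k) f \<longleftrightarrow> (\<forall>x. f differentiable at x) \<and>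
     (\<forall>b. C_k k (\<lambda>x. frechet_derivative f (at x) b))"

definition test_functions :: "'a::euclidean_space set \<Rightarrow> ('a \<Rightarrow> real) set" where
  "test_functions \<Omega> = {\<eta>. (\<forall>k. C_k k \<eta>) \<and> {x. \<eta> x \<noteq> 0} \<Subset> \<Omega>}"

definition energy_integrand ::
  "real \<Rightarrow> ('a::euclidean_space \<Rightarrow> 'a \<Rightarrow> real) \<Rightarrow> ('a \<Rightarrow> real) \<Rightarrow> ('a \<Rightarrow> real) \<Rightarrow> 'a \<times> 'a \<Rightarrow> real" where
  "energy_integrand p K u \<eta> = (\<lambda>(x, y).
     \<bar>u x - u y\<bar> powr (p - 2) * (u x - u y) * (\<eta> x - \<eta> y) * K x y)"

text \<open>
  The integral in the library is 0 for non-integrable functions, so integrability is demanded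
  explicitly. Nothing is lost: \<open>u \<in> sobolev_loc s p \<Omega>\<close> and the tail bound on the negative part of
  \<open>u\<close> make the positive part of the integrand integrable for nonnegative \<open>\<eta>\<close>, so the integral
  always exists in [-\<open>\<infinity>\<close>, \<open>\<infinity>\<close>) and is nonnegative only if the integrand is integrable.
\<close>

definition weak_supersolution ::
  "real \<Rightarrow> real \<Rightarrow> ('a::euclidean_space \<Rightarrow> 'a \<Rightarrow> real) \<Rightarrow> 'a set \<Rightarrow> ('a \<Rightarrow> real) \<Rightarrow> bool" where
  "weak_supersolution s p K \<Omega> u \<longleftrightarrow>
     u \<in> borel_measurable lebesgue \<and>
     u \<in> sobolev_loc s p \<Omega> \<and>
     (\<lambda>x. ereal (max (- u x) 0)) \<in> tail_space s p \<and>
     (\<forall>\<eta>\<in>test_functions \<Omega>. (\<forall>x. 0 \<le> \<eta> x) \<longrightarrow>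
        integrable lebesgue (energy_integrand p K u \<eta>) \<and>
        0 \<le> integral\<^sup>L lebesgue (energy_integrand p K u \<eta>))"

definition weak_subsolution ::
  "real \<Rightarrow> real \<Rightarrow> ('a::euclidean_space \<Rightarrow> 'a \<Rightarrow> real) \<Rightarrow> 'a set \<Rightarrow> ('a \<Rightarrow> real) \<Rightarrow> bool" where
  "weak_subsolution s p K \<Omega> u \<longleftrightarrow> weak_supersolution s p K \<Omega> (\<lambda>x. - u x)"

definition weak_solution ::
  "real \<Rightarrow> real \<Rightarrow> ('a::euclidean_space \<Rightarrow> 'a \<Rightarrow> real) \<Rightarrow> 'a set \<Rightarrow> ('a \<Rightarrow> real) \<Rightarrow> bool" where
  "weak_solution s p K \<Omega> u \<longleftrightarrow>
     weak_supersolution s p K \<Omega> u \<and> weak_subsolution s p K \<Omega> u"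

definition lower_semicontinuous_on :: "'a::euclidean_space set \<Rightarrow> ('a \<Rightarrow> ereal) \<Rightarrow> bool" where
  "lower_semicontinuous_on \<Omega> u \<longleftrightarrow> (\<forall>x\<in>\<Omega>. u x \<le> Liminf (at x within \<Omega>) u)"

definition comparison_principle ::
  "real \<Rightarrow> real \<Rightarrow> ('a::euclidean_space \<Rightarrow> 'a \<Rightarrow> real) \<Rightarrow> 'a set \<Rightarrow> ('a \<Rightarrow> ereal) \<Rightarrow> bool" where
  "comparison_principle s p K \<Omega> u \<longleftrightarrow>
     (\<forall>D v. open D \<and> D \<Subset> \<Omega> \<and>
        weak_solution s p K D v \<and> continuous_on (closure D) v \<and>
        (\<exists>M. AE x in lebesgue. max (v x) 0 \<le> M) \<and>
        (\<forall>x\<in>frontier D. ereal (v x) \<le> u x) \<and>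
        (AE x in lebesgue. x \<notin> D \<longrightarrow> ereal (v x) \<le> u x) \<longrightarrow>
        (\<forall>x\<in>D. ereal (v x) \<le> u x))"

definition superharmonic ::
  "real \<Rightarrow> real \<Rightarrow> ('a::euclidean_space \<Rightarrow> 'a \<Rightarrow> real) \<Rightarrow> 'a set \<Rightarrow> ('a \<Rightarrow> ereal) \<Rightarrow> bool" where
  "superharmonic s p K \<Omega> u \<longleftrightarrow>
     u \<in> borel_measurable lebesgue \<and>
     (AE x in lebesgue. x \<in> \<Omega> \<longrightarrow> u x < \<infinity>) \<and> (\<forall>x\<in>\<Omega>. - \<infinity> < u x) \<and>
     lower_semicontinuous_on \<Omega> u \<and>
     comparison_principle s p K \<Omega> u \<and>
     (\<lambda>x. max (- u x) 0) \<in> tail_space s p"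

text \<open>
  The limit, as the radius tends to 0, of the essential suprema of \<open>g\<close> over the part of the ball
  in \<open>A\<close>; these decrease with the radius. The value is \<open>-\<infinity>\<close> if that part is null for some radius.
\<close>

definition ess_lim_sup :: "'a::euclidean_space set \<Rightarrow> ('a \<Rightarrow> ereal) \<Rightarrow> 'a \<Rightarrow> ereal" where
  "ess_lim_sup A g x = (INF r\<in>{0<..}. esssup (lebesgue_on (ball x r \<inter> A)) g)"

definition upper_class ::
  "real \<Rightarrow> real \<Rightarrow> ('a::euclidean_space \<Rightarrow> 'a \<Rightarrow> real) \<Rightarrow> 'a set \<Rightarrow> ('a \<Rightarrow> ereal) \<Rightarrow> ('a \<Rightarrow> ereal) set" where
  "upper_class s p K \<Omega> g = {u.
     superharmonic s p K \<Omega> u \<and>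
     (\<exists>m::real. \<forall>x\<in>\<Omega>. ereal m \<le> u x) \<and>
     (\<forall>x\<in>frontier \<Omega>. ess_lim_sup (- \<Omega>) g x \<le> Liminf (at x within \<Omega>) u) \<and>
     (AE x in lebesgue. x \<notin> \<Omega> \<longrightarrow> u x = g x)}"

end

theory Submission
  imports Defs
begin

text \<open>
  The function equal to a constant \<open>M \<ge> max 0 (esssup g)\<close> in \<open>\<Omega>\<close> and to \<open>g\<close> elsewhere lies in the
  upper class; \<open>M \<ge> 0\<close> keeps its negative part below that of \<open>g\<close>. Its comparison property is the
  weak maximum principle for weak subsolutions \<open>v\<close> in \<open>D\<close> that are continuous on the closure of \<open>D\<close>.
  If \<open>v\<close> exceeds \<open>c > M\<close> somewhere in \<open>D\<close>, then \<open>w = (v - c)\<^sub>+\<close> is continuous with compact support in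
  \<open>D\<close>, and its mollifications \<open>\<eta> k\<close> are admissible test functions, with energy at most 0. Near the
  diagonal, \<open>a powr (p - 1) * b \<le> a powr p + b powr p\<close> bounds the energy integrand of \<open>\<eta> k\<close> by the
  Gagliardo integrand of \<open>v\<close> plus an average of translates of that of \<open>w\<close>; these majorants converge
  pointwise and their integrals do not exceed that of the limit. Fatou's lemma then shows that the
  nonnegative energy integrand of \<open>w\<close> vanishes almost everywhere, although it is positive almost
  everywhere on \<open>{w > 0} \<times> (- closure D)\<close>.
\<close>

section \<open>Smooth functions and convolution\<close>

lemma C_k_Suc_D: "C_k (Suc k) f \<Longrightarrow> C_k k f"
proof (induction k arbitrary: f)
  case 0
  then show ?case
    by (auto intro!: continuous_at_imp_continuous_on differentiable_imp_continuous_within)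
next
  case (Suc k)
  then show ?case by (auto simp del: C_k.simps(1))
qed

lemma C_k_const: "C_k k (\<lambda>x::'a::euclidean_space. c)"
  by (induction k arbitrary: c) auto

text \<open>Derivatives are unique, so any explicit formula \<open>f'\<close> may stand in for
  \<open>frechet_derivative\<close>. The inductive steps for sums, products, radial functions and
  convolutions use this rule.\<close>

lemma C_k_SucI:
  assumes "\<And>x. (f has_derivative f' x) (at x)" "\<And>b. C_k k (\<lambda>x. f' x b)"
  shows "C_k (Suc k) f"
proof -
  have "frechet_derivative f (at x) = f' x" for x
    using assms(1) frechet_derivative_at by metis
  then show ?thesis
    using assms by (auto simp: differentiable_def)
qed

lemma C_k_Suc_has_derivative:
  "C_k (Suc k) f \<Longrightarrow> (f has_derivative frechet_derivative f (at x)) (at x)"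
  by (simp add: frechet_derivative_works)

lemma C_k_add: "C_k k f \<Longrightarrow> C_k k g \<Longrightarrow> C_k k (\<lambda>x. f x + g x)"
proof (induction k arbitrary: f g)
  case (Suc k)
  show ?case
    by (rule C_k_SucI[OF has_derivative_add[OF Suc.prems[THEN C_k_Suc_has_derivative]]])
      (use Suc in auto)
qed (auto intro: continuous_on_add)

lemma C_k_mult: "C_k k f \<Longrightarrow> C_k k g \<Longrightarrow> C_k k (\<lambda>x. f x * g x)"
proof (induction k arbitrary: f g)
  case (Suc k)
  show ?case
    by (rule C_k_SucI[OF has_derivative_mult[OF Suc.prems[THEN C_k_Suc_has_derivative]]])
      (intro C_k_add Suc.IH; use Suc.prems C_k_Suc_D in auto)
qed (auto intro: continuous_on_mult)

section \<open>The flat exponential and smooth bump functions\<close>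

text \<open>\<open>m = 0\<close> is the classical function exp(-1/t), extended by 0. The extra
  powers make the span of the family closed under differentiation, which permits an induction over
  all \<open>m\<close> at once.\<close>

definition flat :: "nat \<Rightarrow> real \<Rightarrow> real" where
  "flat m t = (if t > 0 then exp (- inverse t) * inverse t ^ m else 0)"

lemma flat_tendsto_0: "(flat m \<longlongrightarrow> 0) (at 0)"
proof -
  have "((\<lambda>t. inverse t ^ m / exp (inverse t)) \<longlongrightarrow> (0::real)) (at_right 0)"
    using tendsto_power_div_exp_0 filterlim_inverse_at_top_right by (rule filterlim_compose)
  then have "(flat m \<longlongrightarrow> 0) (at_right 0)"
    by (rule Lim_transform_eventually)
      (auto simp: flat_def eventually_at_filter exp_minus field_simps)
  moreover have "(flat m \<longlongrightarrow> 0) (at_left 0)"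
    by (rule tendsto_eventually) (auto simp: flat_def eventually_at_filter)
  ultimately show ?thesis by (simp add: filterlim_at_split)
qed

lemma flat_has_derivative:
  "(flat m has_field_derivative flat (m + 2) t - real m * flat (m + 1) t) (at t)"
proof (cases t "0 :: real" rule: linorder_cases)
  case less
  have "((\<lambda>_. 0) has_field_derivative 0) (at t)" by simp
  then have "(flat m has_field_derivative 0) (at t)"
    by (rule has_field_derivative_transform_within_open[of _ _ _ "{..<0}"])
      (use less in \<open>auto simp: flat_def\<close>)
  then show ?thesis using less by (simp add: flat_def)
next
  case equal
  \<comment> \<open>The difference quotient of \<open>flat m\<close> at 0 is
    \<open>flat (Suc m)\<close>, whose limit is already known.\<close>
  have "((\<lambda>h. (flat m (0 + h) - flat m 0) / h) \<longlongrightarrow> 0) (at 0)"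
    by (rule Lim_transform_eventually[OF flat_tendsto_0[of "Suc m"]])
      (auto simp: flat_def eventually_at_filter field_simps)
  then show ?thesis
    unfolding equal by (simp add: DERIV_def flat_def)
next
  case greater
  have "((\<lambda>t. exp (- inverse t) * inverse t ^ m) has_field_derivative
      flat (m + 2) t - real m * flat (m + 1) t) (at t)"
  proof -
    \<comment> \<open>Truncated subtraction in the exponent is harmless at \<open>m = 0\<close>,
      since the factor \<open>real m\<close> vanishes.\<close>
    have "real m * inverse t ^ (m - Suc 0) * (inverse t)\<^sup>2 = real m * inverse t ^ (m + 1)"
      by (cases m) (auto simp: power2_eq_square)
    then have 1: "((\<lambda>t. inverse t ^ m) has_field_derivative - (real m * inverse t ^ (m + 1))) (at t)"
      using greater
      by (auto intro!: derivative_eq_intros simp: power2_eq_square algebra_simps)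
    have 2: "((\<lambda>t. exp (- inverse t)) has_field_derivative exp (- inverse t) * (inverse t)\<^sup>2) (at t)"
      using greater by (auto intro!: derivative_eq_intros simp: power2_eq_square)
    show ?thesis
      using DERIV_mult[OF 2 1] greater by (simp add: flat_def power2_eq_square algebra_simps)
  qed
  then show ?thesis
    by (rule has_field_derivative_transform_within_open[of _ _ _ "{0<..}"])
      (use greater in \<open>auto simp: flat_def\<close>)
qed

text \<open>The argument is a polynomial in \<open>x\<close> rather than a function of the norm,
  which avoids a singularity at the origin. Normalisation is left to
  \<open>bump_mass\<close>.\<close>

definition bump :: "real \<Rightarrow> 'a::euclidean_space \<Rightarrow> real" where
  "bump e x = flat 0 (e\<^sup>2 - x \<bullet> x)"

lemma C_k_inner: "C_k k (\<lambda>x::'a::euclidean_space. x \<bullet> b)"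
  by (cases k)
    (auto intro!: C_k_const C_k_SucI[where f' = "\<lambda>_ y. y \<bullet> b"] derivative_eq_intros
      continuous_intros simp del: C_k.simps(2))

lemma C_k_flat_radial: "C_k k (\<lambda>x::'a::euclidean_space. flat m (c - x \<bullet> x))"
proof (induction k arbitrary: m)
  case 0
  have "continuous_on UNIV (flat m)"
    using flat_has_derivative by (intro DERIV_continuous_on) auto
  then show ?case
    by (auto intro!: continuous_on_compose2[of UNIV "flat m"] continuous_intros)
next
  case (Suc k)
  show ?case
  proof (rule C_k_SucI)
    fix x :: 'a
    have d: "((\<lambda>x. c - x \<bullet> x) has_derivative (\<lambda>b. (-2) * (x \<bullet> b))) (at x)"
      by (auto intro!: derivative_eq_intros simp: inner_commute)
    show "((\<lambda>x. flat m (c - x \<bullet> x)) has_derivative (\<lambda>b.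
        (flat (m + 2) (c - x \<bullet> x) + (- real m) * flat (m + 1) (c - x \<bullet> x)) * ((-2) * (x \<bullet> b)))) (at x)"
      using has_derivative_compose[OF d flat_has_derivative[unfolded has_field_derivative_def]]
      by simp
  next
    fix b :: 'a
    show "C_k k (\<lambda>x. (flat (m + 2) (c - x \<bullet> x) + (- real m) * flat (m + 1) (c - x \<bullet> x)) * ((-2) * (x \<bullet> b)))"
      by (intro C_k_add C_k_mult C_k_const C_k_inner Suc)
  qed
qed

lemma C_k_bump: "C_k k (bump e)"
  unfolding bump_def by (rule C_k_flat_radial)

lemma continuous_on_bump: "continuous_on S (bump e)"
  using C_k_bump[of 0 e] continuous_on_subset by auto

lemma bump_nonneg: "0 \<le> bump e x"
  by (simp add: bump_def flat_def)

lemma bump_pos_iff: "0 < e \<Longrightarrow> 0 < bump e x \<longleftrightarrow> norm x < e"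
  using abs_le_square_iff[of e "norm x"]
  by (auto simp: bump_def flat_def power2_norm_eq_inner[symmetric] not_le[symmetric])

lemma bump_eq_0: "0 < e \<Longrightarrow> e \<le> norm x \<Longrightarrow> bump e x = 0"
  using bump_pos_iff[of e x] bump_nonneg[of e x] by (auto simp: order_less_le)

lemma bump_minus: "bump e (- x) = bump e x"
  by (simp add: bump_def)

text \<open>Differentiation under the integral sign puts every derivative on \<open>f\<close>, so
  \<open>w\<close> need only be continuous. Integrating over a compact box makes the Leibniz rule
  applicable.\<close>

lemma C_k_convolution:
  fixes f w :: "'a::euclidean_space \<Rightarrow> real"
  assumes "\<And>k. C_k k f" and w: "continuous_on (cbox a b) w"
  shows "C_k k (\<lambda>x. integral (cbox a b) (\<lambda>y. f (x - y) * w y))"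
  using assms(1)
proof (induction k arbitrary: f)
  case 0
  have cf: "continuous_on UNIV f" using 0[of 0] by simp
  have "continuous_on (UNIV \<times> cbox a b) (\<lambda>(x, y). f (x - y) * w y)"
    unfolding split_beta
    by (intro continuous_intros continuous_on_compose2[OF cf] continuous_on_compose2[OF w]) auto
  then show ?case
    by (simp add: integral_continuous_on_param)
next
  case (Suc k)
  define f' where "f' x = frechet_derivative f (at x)" for x
  have f': "(f has_derivative f' x) (at x)" for x
    unfolding f'_def using C_k_Suc_has_derivative[OF Suc.prems[of "Suc 0"]] .
  have f'C: "C_k j (\<lambda>x. f' x v)" for j v
    using Suc.prems[of "Suc j"] by (simp add: f'_def)
  have cf: "continuous_on UNIV f" using Suc.prems[of 0] by simp
  have cf': "continuous_on UNIV (\<lambda>x. f' x v)" for v using f'C[of 0 v] by simp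
  have bl: "bounded_linear (f' x)" for x using f' has_derivative_bounded_linear by blast
  define D where "D x y = w y *\<^sub>R Blinfun (f' (x - y))" for x y
  have D: "blinfun_apply (D x y) v = f' (x - y) v * w y" for x y v
    by (simp add: D_def scaleR_blinfun.rep_eq bounded_linear_Blinfun_apply bl)
  have cD: "continuous_on (UNIV \<times> cbox a b) (\<lambda>(x, y). D x y)"
    by (rule continuous_on_blinfun_componentwise)
      (auto simp: split_beta D intro!: continuous_intros
        intro: continuous_on_compose2[OF cf'] continuous_on_compose2[OF w])
  have Dint: "D x integrable_on cbox a b" for x
    by (rule integrable_continuous)
       (rule continuous_on_compose2[OF cD, where f = "Pair x", simplified], auto intro!: continuous_intros)
  have *: "((\<lambda>x. integral (cbox a b) (\<lambda>y. f (x - y) * w y)) has_derivative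
      integral (cbox a b) (D x)) (at x)" for x
  proof (rule leibniz_rule[where U = UNIV and fx = D, simplified])
    fix x y
    have "((\<lambda>x. f (x - y)) has_derivative f' (x - y)) (at x)"
      by (rule has_derivative_compose[OF _ f', of "\<lambda>x. x - y" "\<lambda>h. h" x UNIV])
        (auto intro!: derivative_eq_intros)
    then show "((\<lambda>x. f (x - y) * w y) has_derivative D x y) (at x)"
      by (auto intro!: derivative_eq_intros simp: D)
  next
    fix x
    show "(\<lambda>y. f (x - y) * w y) integrable_on cbox a b"
      by (auto intro!: integrable_continuous continuous_intros w continuous_on_compose2[OF cf])
  qed (use cD in auto)
  have **: "blinfun_apply (integral (cbox a b) (D x)) v
      = integral (cbox a b) (\<lambda>y. f' (x - y) v * w y)" for x v
    using integral_linear[OF Dint[of x] blinfun.bounded_linear_left[of v]]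
    by (simp add: o_def D)
  show ?case
    by (rule C_k_SucI[OF *], unfold **, rule Suc.IH, rule f'C)
qed

section \<open>Averages over small balls\<close>

text \<open>Nonempty open sets are not negligible. This turns an almost everywhere statement into a
  witness.\<close>

lemma AE_lebesgue_open_ex:
  fixes S :: "'a::euclidean_space set"
  assumes "open S" "S \<noteq> {}" "AE x in lebesgue. P x"
  shows "\<exists>x\<in>S. P x"
proof (rule ccontr)
  assume "\<not> ?thesis"
  then have "AE x in lebesgue. x \<notin> S"
    using assms(3) by (auto elim: eventually_mono)
  then have "S \<in> null_sets lebesgue"
    using assms(1) by (subst AE_iff_null_sets) auto
  then show False
    using open_not_negligible assms(1,2) by (auto simp: negligible_iff_null_sets)
qed

lemma integrable_bump_mult:
  fixes h :: "'a::euclidean_space \<Rightarrow> real"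
  assumes "0 < e" "continuous_on UNIV h"
  shows "integrable lborel (\<lambda>z. bump e z * h z)"
proof -
  have "integrable lborel (\<lambda>z. indicator (cball 0 e) z *\<^sub>R (bump e z * h z))"
    by (intro borel_integrable_compact continuous_intros continuous_on_bump
        continuous_on_subset[OF assms(2)]) auto
  also have "(\<lambda>z. indicator (cball 0 e) z *\<^sub>R (bump e z * h z)) = (\<lambda>z. bump e z * h z)"
    (is "?l = ?r")
  proof
    show "?l z = ?r z" for z
      using bump_eq_0[OF assms(1), of z] by (cases "e \<le> norm z") auto
  qed
  finally show ?thesis .
qed

text \<open>The mass depends on the space, which \<open>e\<close> does not reveal, hence the type
  argument.\<close>

definition bump_mass :: "'a::euclidean_space itself \<Rightarrow> real \<Rightarrow> real" where
  "bump_mass _ e = (LINT z|lborel. bump e (z::'a))"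

lemma bump_mass_pos: "0 < e \<Longrightarrow> 0 < bump_mass TYPE('a::euclidean_space) e"
proof -
  assume e: "0 < e"
  have int: "integrable lborel (bump e :: 'a \<Rightarrow> real)"
    using integrable_bump_mult[of e "\<lambda>_. 1"] e by simp
  have "bump_mass TYPE('a) e \<noteq> 0"
  proof
    assume "bump_mass TYPE('a) e = 0"
    then have "AE x in lborel. bump e (x::'a) = 0"
      using integral_nonneg_eq_0_iff_AE[OF int] bump_nonneg by (auto simp: bump_mass_def)
    then have "AE x in lebesgue. bump e (x::'a) = 0" by (rule AE_completion)
    then obtain x :: 'a where "x \<in> ball 0 e" "bump e x = 0"
      using AE_lebesgue_open_ex[of "ball (0 :: 'a) e" "\<lambda>x. bump e x = 0"] e by auto
    then show False using bump_pos_iff[OF e, of x] by auto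
  qed
  moreover have "0 \<le> bump_mass TYPE('a) e"
    unfolding bump_mass_def by (intro Bochner_Integration.integral_nonneg) (rule bump_nonneg)
  ultimately show ?thesis by linarith
qed

text \<open>A probability average over the ball of radius \<open>e\<close>. As \<open>bump e\<close>
  is even, \<open>avg e (\<lambda>z. w (x + z))\<close> is the usual mollification of
  \<open>w\<close> at \<open>x\<close>.\<close>

definition avg :: "real \<Rightarrow> ('a::euclidean_space \<Rightarrow> real) \<Rightarrow> real" where
  "avg e h = (LINT z|lborel. bump e z / bump_mass TYPE('a) e * h z)"

context
  fixes e :: real
  assumes e: "0 < e"
begin

lemma integrable_avg:
  "continuous_on UNIV h \<Longrightarrow> integrable lborel (\<lambda>z. bump e z / bump_mass TYPE('a::euclidean_space) e * h z)"
  using integrable_bump_mult[OF e, of h] by simp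

lemma avg_const: "avg e (\<lambda>_::'a::euclidean_space. c) = c"
  using bump_mass_pos[OF e, where ?'a = 'a] by (simp add: avg_def) (simp add: bump_mass_def)

lemma avg_mono:
  fixes h h' :: "'a::euclidean_space \<Rightarrow> real"
  assumes "continuous_on UNIV h" "continuous_on UNIV h'" "\<And>z. norm z < e \<Longrightarrow> h z \<le> h' z"
  shows "avg e h \<le> avg e h'"
  unfolding avg_def
proof (intro integral_mono integrable_avg assms)
  fix z :: 'a
  show "bump e z / bump_mass TYPE('a) e * h z \<le> bump e z / bump_mass TYPE('a) e * h' z"
    using bump_eq_0[OF e, of z] bump_mass_pos[OF e, where ?'a = 'a] bump_nonneg[of e z] assms(3)[of z]
    by (cases "norm z < e") (auto intro!: mult_left_mono divide_right_mono)
qed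

lemma avg_add:
  fixes h h' :: "'a::euclidean_space \<Rightarrow> real"
  assumes "continuous_on UNIV h" "continuous_on UNIV h'"
  shows "avg e (\<lambda>z. h z + h' z) = avg e h + avg e h'"
  using assms by (simp add: avg_def distrib_left integrable_avg del: times_divide_eq_left)

lemma avg_cmult: "avg e (\<lambda>z::'a::euclidean_space. c * h z) = c * avg e h"
  unfolding avg_def by (subst integral_mult_right_zero[symmetric]) (simp add: ac_simps)

lemma avg_diff:
  fixes h h' :: "'a::euclidean_space \<Rightarrow> real"
  assumes "continuous_on UNIV h" "continuous_on UNIV h'"
  shows "avg e (\<lambda>z. h z - h' z) = avg e h - avg e h'"
  using assms by (simp add: avg_def right_diff_distrib integrable_avg del: times_divide_eq_left)

lemma avg_bounds:
  fixes h :: "'a::euclidean_space \<Rightarrow> real"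
  assumes "continuous_on UNIV h"
  shows "(\<And>z. norm z < e \<Longrightarrow> h z \<le> c) \<Longrightarrow> avg e h \<le> c"
    and "(\<And>z. norm z < e \<Longrightarrow> c \<le> h z) \<Longrightarrow> c \<le> avg e h"
  using avg_mono[OF assms, of "\<lambda>_. c"] avg_mono[OF _ assms, of "\<lambda>_. c"] avg_const[of c, where ?'a = 'a]
  by auto

lemma abs_avg_le:
  fixes h :: "'a::euclidean_space \<Rightarrow> real"
  assumes "continuous_on UNIV h"
  shows "\<bar>avg e h\<bar> \<le> avg e (\<lambda>z. \<bar>h z\<bar>)"
proof -
  have "avg e h \<le> avg e (\<lambda>z. \<bar>h z\<bar>)" "avg e (\<lambda>z. - 1 * h z) \<le> avg e (\<lambda>z. \<bar>h z\<bar>)"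
    by (intro avg_mono continuous_intros assms; simp)+
  then show ?thesis unfolding avg_cmult by simp
qed

text \<open>Substituting \<open>y = x + z\<close> moves the dependence on \<open>x\<close> from
  \<open>w\<close> to the smooth bump; the bounded support of \<open>w\<close> confines the integral
  to a box.\<close>

lemma C_k_avg:
  fixes w :: "'a::euclidean_space \<Rightarrow> real"
  assumes w: "continuous_on UNIV w" and "bounded {x. w x \<noteq> 0}"
  shows "C_k k (\<lambda>x. avg e (\<lambda>z. w (x + z)))"
proof -
  obtain a where a: "{x. w x \<noteq> 0} \<subseteq> cbox (- a) a"
    using bounded_subset_cbox_symmetric[OF assms(2)] by blast
  have "(LINT z|lborel. bump e z * w (x + z)) = integral (cbox (- a) a) (\<lambda>y. bump e (x - y) * w y)" for x
  proof -
    have "(LINT z|lborel. bump e z * w (x + z)) = (LINT z|lborel. bump e (x - (x + z)) * w (x + z))"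
      by (simp add: bump_minus)
    also have "\<dots> = (LINT y|distr lborel borel ((+) x). bump e (x - y) * w y)"
      by (intro integral_distr[symmetric] borel_measurable_continuous_onI continuous_intros
          continuous_on_compose2[OF continuous_on_bump[of UNIV]] w) auto
    also have "\<dots> = (LINT y:cbox (- a) a|lborel. bump e (x - y) * w y)"
      using a unfolding lborel_distr_plus set_lebesgue_integral_def
      by (intro Bochner_Integration.integral_cong) (auto simp: indicator_def)
    also have "\<dots> = integral (cbox (- a) a) (\<lambda>y. bump e (x - y) * w y)"
      unfolding set_integrable_def
      by (intro set_borel_integral_eq_integral(2) borel_integrable_compact[folded set_integrable_def]
          continuous_intros continuous_on_compose2[OF continuous_on_bump[of UNIV]]
          continuous_on_subset[OF w]) auto
    finally show ?thesis .
  qed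
  then have "(\<lambda>x. avg e (\<lambda>z. w (x + z))) = (\<lambda>x. 1 / bump_mass TYPE('a) e *
      integral (cbox (- a) a) (\<lambda>y. bump e (x - y) * w y))"
    by (simp add: avg_def)
  then show ?thesis
    by (simp only:) (intro C_k_mult C_k_const C_k_convolution C_k_bump continuous_on_subset[OF w]; simp)
qed

text \<open>By Tonelli the average can be taken last. For fixed \<open>z\<close>, translation by
  \<open>(z, z)\<close> preserves both Lebesgue measure and \<kappa>, so all inner integrals agree,
  and the weights have total mass 1.\<close>

lemma nn_integral_avg_translate:
  fixes \<Phi> \<kappa> :: "'a::euclidean_space \<times> 'a \<Rightarrow> real"
  assumes \<Phi>: "continuous_on UNIV \<Phi>" "\<And>q. 0 \<le> \<Phi> q"
    and \<kappa>: "\<kappa> \<in> borel_measurable borel" "\<And>q. 0 \<le> \<kappa> q" "\<And>q z. \<kappa> (q + (z, z)) = \<kappa> q"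
  shows "(\<integral>\<^sup>+q. ennreal (\<kappa> q * avg e (\<lambda>z. \<Phi> (q + (z, z)))) \<partial>lborel)
    = (\<integral>\<^sup>+q. ennreal (\<kappa> q * \<Phi> q) \<partial>lborel)"
proof -
  let ?m = "bump_mass TYPE('a) e"
  define m :: "'a \<Rightarrow> real" where "m z = bump e z / ?m" for z
  have m0: "0 \<le> m z" for z
    using bump_mass_pos[OF e, where ?'a = 'a] bump_nonneg[of e z] by (simp add: m_def)
  have [measurable]: "m \<in> borel_measurable borel" "\<Phi> \<in> borel_measurable borel"
    using \<Phi> continuous_on_bump[of UNIV e] bump_mass_pos[OF e, where ?'a = 'a]
    by (auto simp: m_def intro!: borel_measurable_continuous_onI continuous_intros)
  note [measurable] = \<kappa>(1)
  have "(\<integral>\<^sup>+q. ennreal (\<kappa> q * avg e (\<lambda>z. \<Phi> (q + (z, z)))) \<partial>lborel)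
      = (\<integral>\<^sup>+q. (\<integral>\<^sup>+z. ennreal (m z) * ennreal (\<kappa> q * \<Phi> (q + (z, z))) \<partial>lborel) \<partial>lborel)"
  proof (rule nn_integral_cong)
    fix q
    have c: "continuous_on UNIV (\<lambda>z. \<Phi> (q + (z, z)))"
      by (intro continuous_on_compose2[OF \<Phi>(1)] continuous_intros) auto
    have "ennreal (avg e (\<lambda>z. \<Phi> (q + (z, z)))) = (\<integral>\<^sup>+z. ennreal (m z * \<Phi> (q + (z, z))) \<partial>lborel)"
      unfolding avg_def m_def
      using integrable_avg[OF c] m0 \<Phi>(2)
      by (intro nn_integral_eq_integral[symmetric]) (auto intro!: divide_nonneg_pos mult_nonneg_nonneg bump_nonneg bump_mass_pos e \<Phi>(2))
    then have "ennreal (\<kappa> q * avg e (\<lambda>z. \<Phi> (q + (z, z))))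
      = (\<integral>\<^sup>+z. ennreal (\<kappa> q) * ennreal (m z * \<Phi> (q + (z, z))) \<partial>lborel)"
      using \<kappa>(2) by (simp add: ennreal_mult' nn_integral_cmult)
    also have "\<dots> = (\<integral>\<^sup>+z. ennreal (m z) * ennreal (\<kappa> q * \<Phi> (q + (z, z))) \<partial>lborel)"
      using \<kappa>(2) m0 \<Phi>(2) by (intro nn_integral_cong) (simp add: ennreal_mult'[symmetric] ac_simps)
    finally show "ennreal (\<kappa> q * avg e (\<lambda>z. \<Phi> (q + (z, z))))
      = (\<integral>\<^sup>+z. ennreal (m z) * ennreal (\<kappa> q * \<Phi> (q + (z, z))) \<partial>lborel)" .
  qed
  also have "\<dots> = (\<integral>\<^sup>+z. (\<integral>\<^sup>+q. ennreal (m z) * ennreal (\<kappa> q * \<Phi> (q + (z, z))) \<partial>lborel) \<partial>lborel)"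
    by (rule lborel_pair.Fubini') measurable
  also have "\<dots> = (\<integral>\<^sup>+z. ennreal (m z) * (\<integral>\<^sup>+q. ennreal (\<kappa> q * \<Phi> q) \<partial>lborel) \<partial>lborel)"
  proof (rule nn_integral_cong)
    fix z :: 'a
    have "(\<integral>\<^sup>+q. ennreal (\<kappa> q * \<Phi> q) \<partial>lborel)
        = (\<integral>\<^sup>+q. ennreal (\<kappa> q * \<Phi> q) \<partial>distr lborel borel ((+) (z, z)))"
      by (simp only: lborel_distr_plus)
    also have "\<dots> = (\<integral>\<^sup>+q. ennreal (\<kappa> q * \<Phi> (q + (z, z))) \<partial>lborel)"
      using \<kappa>(3) by (subst nn_integral_distr) (auto simp: add.commute)
    finally show "(\<integral>\<^sup>+q. ennreal (m z) * ennreal (\<kappa> q * \<Phi> (q + (z, z))) \<partial>lborel)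
        = ennreal (m z) * (\<integral>\<^sup>+q. ennreal (\<kappa> q * \<Phi> q) \<partial>lborel)"
      by (subst nn_integral_cmult) auto
  qed
  also have "\<dots> = (\<integral>\<^sup>+z. ennreal (m z) \<partial>lborel) * (\<integral>\<^sup>+q. ennreal (\<kappa> q * \<Phi> q) \<partial>lborel)"
    by (rule nn_integral_multc) measurable
  also have "(\<integral>\<^sup>+z. ennreal (m z) \<partial>lborel) = ennreal (avg e (\<lambda>_::'a. 1))"
    using integrable_avg[of "\<lambda>_::'a. 1"] m0 unfolding avg_def m_def
    by (subst nn_integral_eq_integral) (auto simp: m_def)
  finally show ?thesis by (simp add: avg_const)
qed

lemma
  fixes \<Phi> \<kappa> :: "'a::euclidean_space \<times> 'a \<Rightarrow> real"
  assumes \<Phi>: "continuous_on UNIV \<Phi>" "\<And>q. 0 \<le> \<Phi> q"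
    and \<kappa>: "\<kappa> \<in> borel_measurable borel" "\<And>q. 0 \<le> \<kappa> q" "\<And>q z. \<kappa> (q + (z, z)) = \<kappa> q"
    and int: "integrable lborel (\<lambda>q. \<kappa> q * \<Phi> q)"
  shows integrable_avg_translate: "integrable lborel (\<lambda>q. \<kappa> q * avg e (\<lambda>z. \<Phi> (q + (z, z))))"
    and integral_avg_translate: "(LINT q|lborel. \<kappa> q * avg e (\<lambda>z. \<Phi> (q + (z, z))))
      = (LINT q|lborel. \<kappa> q * \<Phi> q)"
proof -
  have [measurable]: "\<Phi> \<in> borel_measurable borel" "bump e \<in> borel_measurable (borel :: 'a measure)"
    using \<Phi> continuous_on_bump[of UNIV e] by (auto intro!: borel_measurable_continuous_onI)
  note [measurable] = \<kappa>(1)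
  have meas: "(\<lambda>q. \<kappa> q * avg e (\<lambda>z. \<Phi> (q + (z, z)))) \<in> borel_measurable lborel"
    unfolding avg_def by measurable
  have "0 \<le> avg e (\<lambda>z. \<Phi> (q + (z, z)))" for q
    using \<Phi>(2) by (intro avg_bounds continuous_on_compose2[OF \<Phi>(1)] continuous_intros) auto
  then have nn: "0 \<le> \<kappa> q * avg e (\<lambda>z. \<Phi> (q + (z, z)))" for q
    using \<kappa>(2) by simp
  note eq = nn_integral_avg_translate[OF \<Phi> \<kappa>]
  show *: "integrable lborel (\<lambda>q. \<kappa> q * avg e (\<lambda>z. \<Phi> (q + (z, z))))"
    using int nn \<kappa>(2) \<Phi>(2) meas by (simp add: integrable_iff_bounded eq)
  show "(LINT q|lborel. \<kappa> q * avg e (\<lambda>z. \<Phi> (q + (z, z)))) = (LINT q|lborel. \<kappa> q * \<Phi> q)"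
    using nn \<kappa>(2) \<Phi>(2) meas by (subst (1 2) integral_eq_nn_integral) (auto simp: eq)
qed

end

lemma avg_tendsto:
  fixes h :: "'a::euclidean_space \<Rightarrow> real"
  assumes h: "continuous_on UNIV h" and e: "\<And>k. 0 < e k" "e \<longlonglongrightarrow> 0"
  shows "(\<lambda>k. avg (e k) h) \<longlonglongrightarrow> h 0"
proof (rule tendstoI)
  fix d :: real assume d: "0 < d"
  have "isCont h 0" using h by (simp add: continuous_on_eq_continuous_at)
  then obtain r where r: "0 < r" "\<And>z. norm z < r \<Longrightarrow> \<bar>h z - h 0\<bar> < d / 2"
    using d unfolding continuous_at_eps_delta
    by (metis dist_norm diff_zero half_gt_zero real_norm_def)
  have "\<forall>\<^sub>F k in sequentially. e k < r"
    using e(2) r(1) by (rule order_tendstoD)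
  then show "\<forall>\<^sub>F k in sequentially. dist (avg (e k) h) (h 0) < d"
  proof eventually_elim
    case (elim k)
    have "h z \<le> h 0 + d / 2 \<and> h 0 - d / 2 \<le> h z" if "norm z < e k" for z
      using r(2)[OF less_trans[OF that elim]] by linarith
    then have "avg (e k) h \<le> h 0 + d / 2 \<and> h 0 - d / 2 \<le> avg (e k) h"
      by (intro conjI avg_bounds[OF e(1) h]) auto
    then show ?case using d by (simp add: dist_real_def abs_less_iff) 
  qed
qed

section \<open>The weak maximum principle\<close>

text \<open>Fatou's lemma for \<open>X k + G k\<close> bounds the integral of \<open>X' + G'\<close>
  by that of \<open>G'\<close>; subtracting the latter leaves a nonnegative \<open>X'\<close> with
  integral at most 0. The majorant may vary with \<open>k\<close>, as long as its integral does not
  exceed that of its limit.\<close>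

lemma AE_zero_of_majorized_limit:
  fixes X G :: "nat \<Rightarrow> 'b \<Rightarrow> real"
  assumes int: "\<And>k. integrable M (X k)" "\<And>k. integrable M (G k)" "integrable M G'"
    and le: "\<And>k. integral\<^sup>L M (X k) \<le> 0" "\<And>k. integral\<^sup>L M (G k) \<le> integral\<^sup>L M G'"
    and maj: "\<And>k. AE z in M. 0 \<le> X k z + G k z"
    and lim: "\<And>z. (\<lambda>k. X k z) \<longlonglongrightarrow> X' z" "\<And>z. (\<lambda>k. G k z) \<longlonglongrightarrow> G' z"
    and nonneg: "AE z in M. 0 \<le> X' z" "\<And>z. 0 \<le> G' z"
  shows "AE z in M. X' z = 0"
proof -
  note [measurable] = borel_measurable_integrable[OF int(1)] borel_measurable_integrable[OF int(2)]
    borel_measurable_integrable[OF int(3)]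
  have [measurable]: "X' \<in> borel_measurable M"
    by (rule borel_measurable_LIMSEQ_real[OF lim(1)]) auto
  have sum: "integrable M (\<lambda>z. X k z + G k z)" for k
    using int by simp
  have nn: "(\<integral>\<^sup>+z. ennreal (X' z + G' z) \<partial>M) \<le> ennreal (integral\<^sup>L M G')"
  proof -
    have "(\<integral>\<^sup>+z. ennreal (X' z + G' z) \<partial>M) = (\<integral>\<^sup>+z. liminf (\<lambda>k. ennreal (X k z + G k z)) \<partial>M)"
      by (intro nn_integral_cong lim_imp_Liminf[symmetric] tendsto_ennrealI tendsto_add lim) auto
    also have "\<dots> \<le> liminf (\<lambda>k. \<integral>\<^sup>+z. ennreal (X k z + G k z) \<partial>M)"
      by (rule nn_integral_liminf) measurable
    also have "\<dots> \<le> limsup (\<lambda>k. \<integral>\<^sup>+z. ennreal (X k z + G k z) \<partial>M)"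
      by (rule Liminf_le_Limsup) simp
    also have "\<dots> \<le> ennreal (integral\<^sup>L M G')"
    proof (intro Limsup_bounded always_eventually allI)
      fix k
      have "(\<integral>\<^sup>+z. ennreal (X k z + G k z) \<partial>M) = ennreal (integral\<^sup>L M (X k) + integral\<^sup>L M (G k))"
        using int nn_integral_eq_integral[OF sum maj] by simp
      also have "\<dots> \<le> ennreal (integral\<^sup>L M G')"
        using le[of k] by (intro ennreal_leI) linarith
      finally show "(\<integral>\<^sup>+z. ennreal (X k z + G k z) \<partial>M) \<le> ennreal (integral\<^sup>L M G')" .
    qed
    finally show ?thesis .
  qed
  have "AE z in M. \<forall>k. 0 \<le> X k z + G k z"
    using maj by (simp add: AE_all_countable)
  then have nonneg': "AE z in M. 0 \<le> X' z + G' z"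
  proof eventually_elim
    case (elim z)
    then show ?case
      by (intro tendsto_lowerbound[OF tendsto_add[OF lim(1) lim(2)]]) auto
  qed
  \<comment> \<open>Integrability of the limit is a consequence of the Fatou bound, and it makes the
    subtraction of \<open>G'\<close> legitimate.\<close>
  have intXG: "integrable M (\<lambda>z. X' z + G' z)"
    using nn by (intro integrableI_nonneg nonneg') (auto intro: le_less_trans)
  then have intX: "integrable M X'"
    using Bochner_Integration.integrable_diff[OF intXG int(3)] by simp
  have "0 \<le> integral\<^sup>L M G'"
    using nonneg(2) by simp
  then have "integral\<^sup>L M (\<lambda>z. X' z + G' z) \<le> integral\<^sup>L M G'"
    using nn nn_integral_eq_integral[OF intXG nonneg'] by simp
  then have "integral\<^sup>L M X' \<le> 0"
    using Bochner_Integration.integral_add[OF intX int(3)] by simp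
  then have "integral\<^sup>L M X' = 0"
    using integral_nonneg_AE[OF nonneg(1)] by simp
  then show ?thesis
    using integral_nonneg_eq_0_iff_AE[OF intX nonneg(1)] by simp
qed

text \<open>The exceptional sets are enlarged to Borel null sets, since it is the Borel versions of
  Lebesgue measure that multiply exactly; the completion is taken afterwards.\<close>

lemma AE_lebesgue_pair:
  fixes P :: "'a::euclidean_space \<Rightarrow> bool" and Q :: "'b::euclidean_space \<Rightarrow> bool"
  assumes "AE x in lebesgue. P x" "AE y in lebesgue. Q y"
  shows "AE z in lebesgue. P (fst z) \<and> Q (snd z)"
proof -
  obtain A B where A: "{x. \<not> P x} \<subseteq> A" "A \<in> null_sets lborel"
    and B: "{y. \<not> Q y} \<subseteq> B" "B \<in> null_sets lborel"
    using assms unfolding AE_completion_iff by (auto simp: eventually_ae_filter)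
  have "A \<times> UNIV \<in> null_sets (lborel :: ('a \<times> 'b) measure)"
      "UNIV \<times> B \<in> null_sets (lborel :: ('a \<times> 'b) measure)"
    using A(2) B(2) unfolding lborel_prod[symmetric] null_sets_def
    by (auto simp: lborel.emeasure_pair_measure_Times)
  then have "A \<times> UNIV \<union> UNIV \<times> B \<in> null_sets (lborel :: ('a \<times> 'b) measure)"
    by (rule null_sets.Un)
  then have "AE z in (lborel :: ('a \<times> 'b) measure). P (fst z) \<and> Q (snd z)"
    by (rule AE_I') (use A(1) B(1) in auto)
  then show ?thesis by (rule AE_completion)
qed

text \<open>A crude Young inequality: replace the smaller of \<open>a\<close> and \<open>b\<close>
  by the larger.\<close>

lemma powr_mult_le_add:
  fixes a b p :: real
  assumes "1 < p" "0 \<le> a" "0 \<le> b"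
  shows "a powr (p - 1) * b \<le> a powr p + b powr p"
proof (cases "b \<le> a")
  case True
  then have "a powr (p - 1) * b \<le> a powr (p - 1) * a powr 1"
    using assms by (intro mult_left_mono) auto
  also have "\<dots> = a powr p" by (subst powr_add[symmetric]) simp
  finally show ?thesis by (simp add: add_increasing2)
next
  case False
  then have "a powr (p - 1) * b \<le> b powr (p - 1) * b powr 1"
    using assms by (intro mult_mono powr_mono2) auto
  also have "\<dots> = b powr p" by (subst powr_add[symmetric]) simp
  finally show ?thesis by (simp add: add_increasing)
qed

lemma abs_energy_integrand_le:
  assumes "0 \<le> K x y" "K x y * norm (x - y) powr q \<le> \<Lambda>" "0 \<le> \<Lambda>"
  shows "\<bar>energy_integrand p K v \<eta> (x, y)\<bar>
    \<le> \<Lambda> * (\<bar>v x - v y\<bar> powr (p - 1) * \<bar>\<eta> x - \<eta> y\<bar> / norm (x - y) powr q)"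
proof (cases "x = y")
  case False
  \<comment> \<open>If \<open>v x = v y\<close>, both sides are 0 even when \<open>p < 2\<close>,
    because \<open>0 powr a = 0\<close> for every \<open>a\<close>.\<close>
  have "\<bar>v x - v y\<bar> powr (p - 2) * \<bar>v x - v y\<bar> = \<bar>v x - v y\<bar> powr (p - 1)"
    using powr_add[of "\<bar>v x - v y\<bar>" "p - 2" 1] by (cases "v x = v y") auto
  then have "\<bar>energy_integrand p K v \<eta> (x, y)\<bar> = K x y * (\<bar>v x - v y\<bar> powr (p - 1) * \<bar>\<eta> x - \<eta> y\<bar>)"
    using assms(1) by (simp add: energy_integrand_def abs_mult)
  also have "\<dots> \<le> \<Lambda> / norm (x - y) powr q * (\<bar>v x - v y\<bar> powr (p - 1) * \<bar>\<eta> x - \<eta> y\<bar>)"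
    using assms(2) False by (intro mult_right_mono) (auto simp: field_simps)
  finally show ?thesis by simp
qed (use assms in \<open>auto simp: energy_integrand_def\<close>)

text \<open>Mollification enlarges the support by at most \<open>e\<close>. The last condition on
  \<open>S\<close> says that \<open>S\<close> contains all points at distance less than
  \<open>e\<close> from a point where \<open>w\<close> is nonzero.\<close>

lemma avg_in_test_functions:
  fixes w :: "'a::euclidean_space \<Rightarrow> real"
  assumes e: "0 < e" and w: "continuous_on UNIV w"
    and S: "compact S" "S \<subseteq> D" "\<And>x z. w (x + z) \<noteq> 0 \<Longrightarrow> norm z < e \<Longrightarrow> x \<in> S"
  shows "(\<lambda>x. avg e (\<lambda>z. w (x + z))) \<in> test_functions D"
proof -
  have "{x. w x \<noteq> 0} \<subseteq> S" using S(3)[of _ 0] e by auto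
  then have "bounded {x. w x \<noteq> 0}"
    using S(1) compact_imp_bounded bounded_subset by blast
  moreover have "{x. avg e (\<lambda>z. w (x + z)) \<noteq> 0} \<subseteq> S"
  proof
    fix x assume x: "x \<in> {x. avg e (\<lambda>z. w (x + z)) \<noteq> 0}"
    have c: "continuous_on UNIV (\<lambda>z. w (x + z))"
      by (intro continuous_on_compose2[OF w] continuous_intros) auto
    show "x \<in> S"
    proof (rule ccontr)
      assume "x \<notin> S"
      then have "w (x + z) = 0" if "norm z < e" for z using S(3) that by blast
      then have "avg e (\<lambda>z. w (x + z)) \<le> 0" "0 \<le> avg e (\<lambda>z. w (x + z))"
        using avg_bounds[OF e c, of 0] by auto
      then show False using x by auto
    qed
  qed
  then have "closure {x. avg e (\<lambda>z. w (x + z)) \<noteq> 0} \<subseteq> S"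
    using S(1) by (simp add: closure_minimal compact_imp_closed)
  then have "{x. avg e (\<lambda>z. w (x + z)) \<noteq> 0} \<Subset> D"
    using S unfolding compactly_contained_def
    by (meson bounded_subset closed_closure compact_eq_bounded_closed subset_trans)
  ultimately show ?thesis
    using C_k_avg[OF e w] by (simp add: test_functions_def)
qed

text \<open>The operator is nonlocal, so a bound is required on the whole complement of
  \<open>D\<close>. The separate bound on the frontier, possibly a null set, makes the truncation of
  \<open>v\<close> continuous with compact support in \<open>D\<close>.\<close>

lemma weak_maximum_principle:
  fixes D :: "'a::euclidean_space set" and v :: "'a \<Rightarrow> real"
  assumes p: "1 < p" and sp: "0 \<le> s * p" and \<Lambda>: "1 \<le> \<Lambda>" and K: "admissible_kernel s p \<Lambda> K"
    and D: "open D" "compact (closure D)"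
    and sub: "weak_subsolution s p K D v" and cont: "continuous_on (closure D) v"
    and front: "\<And>x. x \<in> frontier D \<Longrightarrow> v x \<le> M"
    and out: "AE x in lebesgue. x \<notin> D \<longrightarrow> v x \<le> M"
    and x0: "x0 \<in> D"
  shows "v x0 \<le> M"
proof (rule ccontr)
  assume "\<not> v x0 \<le> M"
  \<comment> \<open>Strictly between the two values: \<open>M < c\<close> keeps the set where
    \<open>v\<close> is at least \<open>c\<close> off the frontier, and \<open>c < v x0\<close>
    makes the truncation nonzero.\<close>
  define c where "c = (v x0 + M) / 2"
  have c: "M < c" "c < v x0" using \<open>\<not> v x0 \<le> M\<close> by (auto simp: c_def)
  define q where "q = real DIM('a) + s * p"
  have q: "0 \<le> q" using sp by (simp add: q_def)

  \<comment> \<open>The truncation of the subsolution\<close>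
  have "bounded (v ` closure D)"
    using D(2) cont compact_continuous_image compact_imp_bounded by blast
  then obtain W0 where W0: "\<And>x. x \<in> closure D \<Longrightarrow> \<bar>v x\<bar> \<le> W0"
    unfolding bounded_iff by auto
  \<comment> \<open>Outside the closure of \<open>D\<close> the function \<open>v\<close> is merely
    measurable. Setting \<open>w\<close> to 0 off \<open>D\<close> makes it continuous everywhere
    and changes (v - c)_+ only on a null set.\<close>
  define w where "w x = (if x \<in> D then max (v x - c) 0 else 0)" for x
  define W where "W = \<bar>W0\<bar> + \<bar>c\<bar>"
  have w0: "0 \<le> w x" for x by (simp add: w_def)
  have W: "w x \<le> W" "0 \<le> W" for x
    using W0[of x] closure_subset[of D] by (auto simp: w_def W_def)
  have w: "continuous_on UNIV w"
  proof -
    have "continuous_on (closure D \<union> - D) (\<lambda>x. if x \<in> D then max (v x - c) 0 else 0)"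
    proof (rule continuous_on_cases)
      show "\<forall>x. x \<in> closure D \<and> \<not> x \<in> D \<or> x \<in> - D \<and> x \<in> D \<longrightarrow> max (v x - c) 0 = 0"
        using front c D(1) by (force simp: frontier_def interior_open)
    qed (use D in \<open>auto intro!: continuous_intros cont\<close>)
    moreover have "closure D \<union> - D = UNIV" using closure_subset by auto
    ultimately show ?thesis by (simp add: w_def)
  qed
  have w_AE: "AE x in lebesgue. w x = max (v x - c) 0"
    using out by eventually_elim (use c in \<open>auto simp: w_def\<close>)

  define K0 where "K0 = {x \<in> closure D. c \<le> v x}"
  have K0D: "K0 \<subseteq> D"
    using front c closure_Un_frontier[of D] by (force simp: K0_def)
  have K0: "compact K0" "K0 \<noteq> {}"
  proof -
    have "K0 = closure D \<inter> v -` {c..}" by (auto simp: K0_def)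
    then have "closed K0"
      using continuous_closed_preimage[OF cont closed_closure, of "{c..}"] by simp
    moreover have "closure D \<inter> K0 = K0" by (auto simp: K0_def)
    ultimately show "compact K0"
      using compact_Int_closed[OF D(2), of K0] by simp
    show "K0 \<noteq> {}"
      using x0 c closure_subset[of D] by (auto simp: K0_def intro!: exI[of _ x0])
  qed
  have wK0: "x \<in> K0" if "w x \<noteq> 0" for x
    using that closure_subset[of D] by (auto simp: w_def K0_def split: if_splits)

  \<comment> \<open>Nested neighbourhoods of \<open>K0\<close> and test functions\<close>
  have "\<exists>d>0. \<forall>x\<in>K0. \<forall>y\<in>- D. d \<le> dist x y"
    using D(1) K0D by (intro separate_compact_closed K0) auto
  then obtain d where d: "0 < d" "\<And>x y. x \<in> K0 \<Longrightarrow> y \<notin> D \<Longrightarrow> d \<le> dist x y"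
    by (metis ComplI)
  \<comment> \<open>\<open>K0\<close> has distance at least \<open>6 * r\<close> from the complement
    of \<open>D\<close>. This leaves room for the neighbourhoods of radius \<open>r\<close>
    (supports of \<open>\<eta> k\<close>), \<open>4 * r\<close> (support of \<open>\<eta>0\<close>)
    and \<open>5 * r\<close> (the set \<open>U\<close>).\<close>
  define r where "r = d / 6"
  have r: "0 < r" using d by (simp add: r_def)
  define h where "h x = infdist x K0" for x
  have h0: "h x = 0" if "x \<in> K0" for x using that by (simp add: h_def)
  have h_triangle: "h x \<le> h y + dist x y" for x y
    unfolding h_def by (rule infdist_triangle)
  have h_le: "h x \<le> dist x y" if "y \<in> K0" for x y
    unfolding h_def using that by (rule infdist_le)
  have hc: "continuous_on UNIV h" unfolding h_def by (intro continuous_intros)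
  have hD: "x \<in> D" if "h x \<le> 5 * r" for x
  proof (rule ccontr)
    assume "x \<notin> D"
    obtain y where "y \<in> K0" "h x = dist x y"
      using infdist_attains_inf[OF _ K0(2)] K0(1) compact_imp_closed unfolding h_def by metis
    then show False using d(2)[of y x] \<open>x \<notin> D\<close> that r by (simp add: r_def dist_commute)
  qed
  have h_sublevel: "compact {x. h x \<le> t}" if "t \<le> 5 * r" for t
  proof -
    have "closed {x. h x \<le> t}"
      using hc by (intro closed_Collect_le) auto
    moreover have "{x. h x \<le> t} \<subseteq> closure D"
      using hD that closure_subset[of D] by force
    ultimately show ?thesis
      using D(2) compact_imp_bounded bounded_subset compact_eq_bounded_closed by blast
  qed

  define e where "e k = r / real (Suc k)" for k
  have e: "0 < e k" "e k \<le> r" for k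
    using r by (auto simp: e_def field_simps)
  have e_lim: "e \<longlonglongrightarrow> 0"
    unfolding e_def using LIMSEQ_Suc[OF lim_const_over_n[of r]] by simp

  \<comment> \<open>Averaged at scale \<open>r\<close>, this becomes a test function
    \<open>\<eta>0\<close> that is at least \<open>r\<close> wherever \<open>h x \<le> r\<close>,
    hence on the supports of all \<open>\<eta> k\<close>.\<close>
  define f where "f x = max 0 (3 * r - h x)" for x
  have f: "continuous_on UNIV f"
    unfolding f_def by (intro continuous_intros hc)
  define \<eta> where "\<eta> k x = avg (e k) (\<lambda>z. w (x + z))" for k x
  define \<eta>0 where "\<eta>0 x = avg r (\<lambda>z. f (x + z))" for x
  have wc: "continuous_on UNIV (\<lambda>z. w (x + z))" and fc: "continuous_on UNIV (\<lambda>z. f (x + z))" for x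
    by (intro continuous_on_compose2[OF w] continuous_on_compose2[OF f] continuous_intros; simp)+
  have hz: "h x \<le> h (x + z) + norm z" "h (x + z) \<le> h x + norm z" for x z
    using h_triangle[of x "x + z"] h_triangle[of "x + z" x] by (auto simp: dist_norm)
  have \<eta>_test: "\<eta> k \<in> test_functions D" for k
    unfolding \<eta>_def
  proof (rule avg_in_test_functions[OF e(1) w h_sublevel[of r]])
    show "{x. h x \<le> r} \<subseteq> D" using hD r by auto
    show "x \<in> {x. h x \<le> r}" if "w (x + z) \<noteq> 0" "norm z < e k" for x z
      using hz(1)[of x z] h0[OF wK0[OF that(1)]] that(2) e(2)[of k] by simp
  qed (use r in auto)
  have \<eta>0_test: "\<eta>0 \<in> test_functions D"
    unfolding \<eta>0_def
  proof (rule avg_in_test_functions[OF r f h_sublevel[of "4 * r"]])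
    show "{x. h x \<le> 4 * r} \<subseteq> D" using hD r by auto
    show "x \<in> {x. h x \<le> 4 * r}" if "f (x + z) \<noteq> 0" "norm z < r" for x z
      using hz(1)[of x z] that by (auto simp: f_def max_def split: if_splits)
  qed (use r in auto)
  have \<eta>_nonneg: "0 \<le> \<eta> k x" for k x
    unfolding \<eta>_def by (intro avg_bounds[OF e(1) wc] w0)
  have \<eta>0_nonneg: "0 \<le> \<eta>0 x" for x
    unfolding \<eta>0_def by (intro avg_bounds[OF r fc]) (simp add: f_def)
  \<comment> \<open>Off \<open>U \<times> U\<close> this bounds the energy of \<open>\<eta> k\<close> by a multiple of that of the fixed \<open>\<eta>0\<close>, whose
    integrability is part of the definition of a weak subsolution.\<close>
  have \<eta>_le: "\<eta> k x \<le> W / r * \<eta>0 x" for k x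
  proof (cases "h x \<le> r")
    case True
    have "r \<le> \<eta>0 x"
      unfolding \<eta>0_def
    proof (intro avg_bounds[OF r fc])
      fix z :: 'a assume "norm z < r"
      then show "r \<le> f (x + z)"
        using hz(2)[of x z] True by (simp add: f_def)
    qed
    then have "W \<le> W / r * \<eta>0 x"
      using mult_left_mono[of r "\<eta>0 x" "W / r"] W(2) r by simp
    moreover have "\<eta> k x \<le> W"
      unfolding \<eta>_def by (intro avg_bounds[OF e(1) wc] W)
    ultimately show ?thesis by simp
  next
    case False
    have "w (x + z) \<le> 0" if "norm z < e k" for z
      using hz(1)[of x z] h0[OF wK0[of "x + z"]] that e(2)[of k] False by force
    then have "\<eta> k x \<le> 0"
      unfolding \<eta>_def by (intro avg_bounds[OF e(1) wc])
    then show ?thesis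
      using W(2) r \<eta>0_nonneg[of x] by (meson divide_nonneg_pos mult_nonneg_nonneg order_trans)
  qed
  have \<eta>0_out: "\<eta>0 x = 0" if "5 * r \<le> h x" for x
  proof -
    have "f (x + z) \<le> 0" if "norm z < r" for z
      using hz(1)[of x z] that \<open>5 * r \<le> h x\<close> r by (simp add: f_def)
    then have "\<eta>0 x \<le> 0"
      unfolding \<eta>0_def by (intro avg_bounds[OF r fc])
    then show ?thesis using \<eta>0_nonneg[of x] by simp
  qed
  have \<eta>_out: "\<eta> k x = 0" if "5 * r \<le> h x" for k x
    using \<eta>_le[of k x] \<eta>_nonneg[of k x] \<eta>0_out[OF that] by simp

  \<comment> \<open>All test functions vanish off \<open>U\<close>, and points off \<open>U\<close>
    keep distance at least \<open>5 * r\<close> from \<open>K0\<close>, away from the singularity of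
    the kernel.\<close>
  define U where "U = {x. h x < 5 * r}"
  have U: "open U" "U \<subseteq> D" "U \<Subset> D"
  proof -
    show "open U" unfolding U_def using hc by (intro open_Collect_less) auto
    show "U \<subseteq> D" using hD by (auto simp: U_def)
    have "closure U \<subseteq> {x. h x \<le> 5 * r}"
      using compact_imp_closed[OF h_sublevel[of "5 * r"]] by (intro closure_minimal) (auto simp: U_def)
    then show "U \<Subset> D"
      using h_sublevel[of "5 * r"] hD unfolding compactly_contained_def
      by (auto intro: bounded_subset simp: compact_eq_bounded_closed)
  qed
  obtain \<rho> where \<rho>: "0 < \<rho>" "closure D \<subseteq> ball 0 \<rho>"
    using bounded_subset_ballD[OF compact_imp_bounded[OF D(2)], of 0] by blast
  have D_norm: "norm x < \<rho>" if "x \<in> D" for x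
    using subsetD[OF \<rho>(2) subsetD[OF closure_subset that]] by simp

  \<comment> \<open>Integrable majorants of the energies\<close>
  define X where "X k = energy_integrand p K v (\<eta> k)" for k
  define H where "H z = \<bar>energy_integrand p K v \<eta>0 z\<bar>" for z
  have sub_int: "integrable lebesgue (energy_integrand p K v \<phi>)"
      "integral\<^sup>L lebesgue (energy_integrand p K v \<phi>) \<le> 0"
    if "\<phi> \<in> test_functions D" "\<And>x. 0 \<le> \<phi> x" for \<phi>
  proof -
    \<comment> \<open>The integrand is odd in its function argument, so the inequality for
      \<open>-v\<close> changes sign.\<close>
    have "energy_integrand p K (\<lambda>x. - v x) \<phi> = (\<lambda>z. - energy_integrand p K v \<phi> z)"
      by (auto simp: energy_integrand_def abs_minus_commute algebra_simps fun_eq_iff)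
    then show "integrable lebesgue (energy_integrand p K v \<phi>)"
      "integral\<^sup>L lebesgue (energy_integrand p K v \<phi>) \<le> 0"
      using sub that unfolding weak_subsolution_def weak_supersolution_def by auto
  qed
  have H: "integrable lebesgue H"
    unfolding H_def using sub_int(1)[OF \<eta>0_test \<eta>0_nonneg] by (rule integrable_abs)

  define V where "V z = (if fst z \<in> U \<and> snd z \<in> U
    then \<bar>v (fst z) - v (snd z)\<bar> powr p / norm (fst z - snd z) powr q else 0)" for z :: "'a \<times> 'a"
  have V0: "0 \<le> V z" for z by (simp add: V_def)
  have V: "integrable lborel V"
  proof (rule integrableI_nonneg)
    have [measurable]: "U \<in> sets borel" using U(1) by simp
    \<comment> \<open>Cutting \<open>v\<close> off outside \<open>U\<close> gives a Borel function
      without changing \<open>V\<close>. Thus \<open>V\<close> is Borel and its integral can be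
      taken over \<open>lborel\<close>.\<close>
    define v' where "v' x = indicator U x *\<^sub>R v x" for x
    have [measurable]: "v' \<in> borel_measurable borel"
      unfolding v'_def using cont U(2) closure_subset[of D]
      by (intro borel_measurable_continuous_on_indicator) (auto intro: continuous_on_subset)
    have "V = (\<lambda>z. if fst z \<in> U \<and> snd z \<in> U
        then \<bar>v' (fst z) - v' (snd z)\<bar> powr p / norm (fst z - snd z) powr q else 0)"
      by (auto simp: V_def v'_def)
    also have "\<dots> \<in> borel_measurable (borel \<Otimes>\<^sub>M borel)" by measurable
    finally show "V \<in> borel_measurable lborel" by (simp add: borel_prod)
    have "v \<in> sobolev s p U"
    proof -
      have "(\<lambda>x. - v x) \<in> sobolev s p U"
        using sub U(1,3) by (auto simp: weak_subsolution_def weak_supersolution_def sobolev_loc_def)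
      then show ?thesis
        by (auto simp: sobolev_def abs_minus_commute dest: borel_measurable_uminus)
    qed
    then have "(\<integral>\<^sup>+z\<in>U \<times> U. ennreal (\<bar>v (fst z) - v (snd z)\<bar> powr p /
        norm (fst z - snd z) powr q) \<partial>lebesgue) < \<infinity>"
      by (simp add: sobolev_def q_def)
    also have "(\<integral>\<^sup>+z\<in>U \<times> U. ennreal (\<bar>v (fst z) - v (snd z)\<bar> powr p /
        norm (fst z - snd z) powr q) \<partial>lebesgue) = (\<integral>\<^sup>+z. ennreal (V z) \<partial>lebesgue)"
      by (intro nn_integral_cong) (auto simp: V_def indicator_def)
    finally show "(\<integral>\<^sup>+z. ennreal (V z) \<partial>lborel) < \<infinity>"
      by (simp add: nn_integral_completion)
  qed (use V0 in auto)

  \<comment> \<open>The cutoff depends on \<open>x - y\<close> only, so that diagonal translations preserve \<open>\<kappa>\<close>; its radius is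
    large enough to contain \<open>U \<times> U\<close>, and it makes \<open>\<kappa> * \<Phi>\<close> integrable without estimating a tail.\<close>
  define \<kappa> where "\<kappa> z = (if norm (fst z - snd z) < 2 * \<rho> then 1 / norm (fst z - snd z) powr q else 0)"
    for z :: "'a \<times> 'a"
  define \<Phi> where "\<Phi> z = \<bar>w (fst z) - w (snd z)\<bar> powr p" for z
  have \<Phi>: "continuous_on UNIV \<Phi>" "\<And>z. 0 \<le> \<Phi> z"
    unfolding \<Phi>_def
    by (rule continuous_on_powr';
        use p in \<open>auto intro!: continuous_intros continuous_on_compose2[OF w]\<close>) simp
  have \<kappa>: "\<kappa> \<in> borel_measurable borel" "\<And>z. 0 \<le> \<kappa> z" "\<And>z t. \<kappa> (z + (t, t)) = \<kappa> z"
  proof -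
    have "\<kappa> \<in> borel_measurable (borel \<Otimes>\<^sub>M borel)"
      unfolding \<kappa>_def by measurable
    then show "\<kappa> \<in> borel_measurable borel" by (simp add: borel_prod)
  qed (auto simp: \<kappa>_def)
  have UU: "\<kappa> (x, y) = 1 / norm (x - y) powr q" if "x \<in> U" "y \<in> U" for x y
  proof -
    have "norm x < \<rho>" "norm y < \<rho>" using that U(2) D_norm by blast+
    then show ?thesis using norm_triangle_ineq4[of x y] by (simp add: \<kappa>_def)
  qed
  define B where "B = W powr p / (5 * r) powr q"
  have B0: "0 \<le> B" by (simp add: B_def)
  define Q where "Q = (cball 0 (3 * \<rho>) :: ('a) set)"
  \<comment> \<open>The distance \<open>5 * r\<close> tames the singularity, and the cutoff in
    \<kappa> confines \<open>y\<close> to the ball of radius \<open>3 * \<rho>\<close>, so a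
    constant on a bounded set suffices.\<close>
  have far: "\<kappa> (x, y) * \<Phi> (x, y) \<le> B * indicator (Q \<times> Q) (x, y)" if "x \<in> K0" "y \<notin> U" for x y
  proof (cases "norm (x - y) < 2 * \<rho>")
    case True
    have "norm x < \<rho>" using that(1) K0D D_norm by blast
    then have Q: "x \<in> Q" "y \<in> Q"
      using True norm_triangle_ineq3[of x y] \<rho>(1) by (auto simp: Q_def)
    have "5 * r \<le> norm (x - y)"
      using h_le[OF that(1), of y] that(2) by (auto simp: U_def dist_norm norm_minus_commute)
    then have "1 / norm (x - y) powr q \<le> 1 / (5 * r) powr q"
      using r q by (intro divide_left_mono powr_mono2 mult_pos_pos) auto
    moreover have "\<bar>w x - w y\<bar> powr p \<le> W powr p"
      using p W(1)[of x] W(1)[of y] w0[of x] w0[of y] by (intro powr_mono2) auto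
    ultimately have "1 / norm (x - y) powr q * (\<bar>w x - w y\<bar> powr p) \<le> 1 / (5 * r) powr q * W powr p"
      by (intro mult_mono) auto
    then show ?thesis using True Q by (simp add: \<kappa>_def \<Phi>_def B_def)
  qed (use B0 in \<open>auto simp: \<kappa>_def\<close>)
  have \<kappa>\<Phi>_le: "\<kappa> z * \<Phi> z \<le> V z + B * indicator (Q \<times> Q) z" for z
  proof -
    obtain x y where z: "z = (x, y)" by (cases z)
    have sym: "\<kappa> (y, x) * \<Phi> (y, x) = \<kappa> (x, y) * \<Phi> (x, y)"
      by (simp add: \<kappa>_def \<Phi>_def norm_minus_commute abs_minus_commute)
    \<comment> \<open>Exhaustive because \<open>w\<close> is nonzero only on \<open>K0\<close>,
      which lies in \<open>U\<close>.\<close>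
    consider "x \<in> U" "y \<in> U" | "x \<in> K0" "y \<notin> U" | "x \<notin> U" "y \<in> K0" | "w x = 0" "w y = 0"
      using wK0 h0 r by (fastforce simp: U_def)
    then show ?thesis
    proof cases
      case 1
      then have "\<bar>w x - w y\<bar> \<le> \<bar>v x - v y\<bar>" using U(2) by (auto simp: w_def max_def)
      then have "\<Phi> (x, y) \<le> \<bar>v x - v y\<bar> powr p"
        using p by (simp add: \<Phi>_def powr_mono2)
      then have "\<kappa> (x, y) * \<Phi> (x, y) \<le> V (x, y)"
        using 1 by (simp add: UU V_def divide_right_mono)
      then show ?thesis using B0 z by (simp add: add_increasing2)
    next
      case 2
      then show ?thesis using far[OF 2] V0[of z] z by simp
    next
      case 3
      then show ?thesis using far[OF 3(2,1)] V0[of z] z sym by (auto simp: indicator_def split: if_splits)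
    next
      case 4
      then show ?thesis using V0[of z] B0 z by (simp add: \<Phi>_def)
    qed
  qed
  have \<kappa>\<Phi>: "integrable lborel (\<lambda>z. \<kappa> z * \<Phi> z)"
  proof (rule Bochner_Integration.integrable_bound)
    have "emeasure lborel (Q \<times> Q) < \<infinity>"
      by (intro emeasure_compact_finite compact_Times) (auto simp: Q_def)
    then show "integrable lborel (\<lambda>z. V z + B * indicator (Q \<times> Q) z)"
      using V by (intro Bochner_Integration.integrable_add integrable_mult_right)
        (auto simp: Q_def intro!: closed_Times borel_closed)
    show "(\<lambda>z. \<kappa> z * \<Phi> z) \<in> borel_measurable lborel"
      using \<kappa>(1) borel_measurable_continuous_onI[OF \<Phi>(1)] by simp
    show "AE z in lborel. norm (\<kappa> z * \<Phi> z) \<le> norm (V z + B * indicator (Q \<times> Q) z)"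
      using \<kappa>\<Phi>_le \<kappa>(2) \<Phi>(2) by (intro AE_I2) (fastforce intro: order_trans)
  qed

  define A where "A k z = \<kappa> z * avg (e k) (\<lambda>t. \<Phi> (z + (t, t)))" for k z
  have A: "integrable lebesgue (A k)" "integral\<^sup>L lebesgue (A k) = (LINT z|lebesgue. \<kappa> z * \<Phi> z)" for k
    using integrable_avg_translate[OF e(1)[of k] \<Phi> \<kappa> \<kappa>\<Phi>] integral_avg_translate[OF e(1)[of k] \<Phi> \<kappa> \<kappa>\<Phi>]
    using borel_measurable_integrable[OF \<kappa>\<Phi>]
      borel_measurable_integrable[OF integrable_avg_translate[OF e(1)[of k] \<Phi> \<kappa> \<kappa>\<Phi>]]
    by (auto simp: A_def[abs_def] integrable_completion integral_completion)
  have VL: "integrable lebesgue V" and \<kappa>\<Phi>L: "integrable lebesgue (\<lambda>z. \<kappa> z * \<Phi> z)"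
    using V \<kappa>\<Phi> borel_measurable_integrable[OF V] borel_measurable_integrable[OF \<kappa>\<Phi>]
    by (auto simp: integrable_completion)
  \<comment> \<open>The first term serves pairs in \<open>U \<times> U\<close>, the second all
    others. By the invariance under diagonal averaging, every \<open>G k\<close> has the same
    integral as \<open>G'\<close>.\<close>
  define G where "G k z = \<Lambda> * (V z + A k z) + W / r * H z" for k z
  define G' where "G' z = \<Lambda> * (V z + \<kappa> z * \<Phi> z) + W / r * H z" for z

  \<comment> \<open>Passage to the limit\<close>
  have kernel: "AE z in lebesgue. 1 / \<Lambda> \<le> K (fst z) (snd z) * norm (fst z - snd z) powr q \<and>
        K (fst z) (snd z) * norm (fst z - snd z) powr q \<le> \<Lambda>"
    using K by (simp add: admissible_kernel_def q_def split_beta)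
  have K_nonneg: "0 \<le> K x y" for x y using K by (simp add: admissible_kernel_def)

  have zero: "AE z in lebesgue. energy_integrand p K v w z = 0"
  proof (rule AE_zero_of_majorized_limit)
    show "integrable lebesgue (X k)" "integral\<^sup>L lebesgue (X k) \<le> 0" for k
      unfolding X_def by (intro sub_int \<eta>_test \<eta>_nonneg)+
    show "integrable lebesgue (G k)" for k
      unfolding G_def using VL A H by auto
    show "integrable lebesgue G'"
      unfolding G'_def using VL \<kappa>\<Phi>L H by auto
    show "integral\<^sup>L lebesgue (G k) \<le> integral\<^sup>L lebesgue G'" for k
      unfolding G_def G'_def using VL A \<kappa>\<Phi>L H by simp
    show "0 \<le> G' z" for z
      using \<Lambda> V0[of z] \<kappa>(2)[of z] \<Phi>(2)[of z] W(2) r by (simp add: G'_def H_def)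
    show "AE z in lebesgue. 0 \<le> X k z + G k z" for k
      using kernel
    proof eventually_elim
      case (elim z)
      obtain x y where z: "z = (x, y)" by (cases z)
      have A_nonneg: "0 \<le> A k z"
        unfolding A_def using \<kappa>(2) \<Phi>(2)
        by (intro mult_nonneg_nonneg avg_bounds[OF e(1)] continuous_on_compose2[OF \<Phi>(1)]
            continuous_intros) auto
      have "\<bar>X k z\<bar> \<le> G k z"
      proof (cases "x \<in> U \<and> y \<in> U")
        case True
        define a where "a = \<bar>v x - v y\<bar>"
        define b where "b t = \<bar>w (x + t) - w (y + t)\<bar>" for t
        have bc: "continuous_on UNIV b"
          unfolding b_def by (intro continuous_intros wc)
        have bpc: "continuous_on UNIV (\<lambda>t. b t powr p)"
          by (rule continuous_on_powr'[OF bc]) (use p in \<open>auto simp: b_def\<close>)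
        have "\<bar>\<eta> k x - \<eta> k y\<bar> \<le> avg (e k) b"
          unfolding \<eta>_def b_def avg_diff[OF e(1) wc wc, symmetric]
          by (intro abs_avg_le[OF e(1)] continuous_intros wc)
        then have "a powr (p - 1) * \<bar>\<eta> k x - \<eta> k y\<bar> \<le> a powr (p - 1) * avg (e k) b"
          by (intro mult_left_mono) auto
        also have "\<dots> = avg (e k) (\<lambda>t. a powr (p - 1) * b t)"
          by (rule avg_cmult[OF e(1), symmetric])
        \<comment> \<open>Using the Young inequality inside the average spares comparing a power of
          an average with the average of powers.\<close>
        also have "\<dots> \<le> avg (e k) (\<lambda>t. a powr p + b t powr p)"
          by (intro avg_mono[OF e(1)] continuous_intros bc bpc powr_mult_le_add p) (auto simp: a_def b_def)
        also have "\<dots> = a powr p + avg (e k) (\<lambda>t. b t powr p)"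
          by (simp add: avg_add[OF e(1) _ bpc] avg_const[OF e(1)])
        finally have "a powr (p - 1) * \<bar>\<eta> k x - \<eta> k y\<bar> / norm (x - y) powr q
            \<le> (a powr p + avg (e k) (\<lambda>t. b t powr p)) / norm (x - y) powr q"
          by (intro divide_right_mono) auto
        also have "\<dots> = V z + A k z"
          using True by (simp add: z V_def A_def \<Phi>_def UU a_def b_def add_divide_distrib)
        finally have "\<Lambda> * (a powr (p - 1) * \<bar>\<eta> k x - \<eta> k y\<bar> / norm (x - y) powr q) \<le> \<Lambda> * (V z + A k z)"
          using \<Lambda> by (intro mult_left_mono) auto
        moreover have "\<bar>X k z\<bar> \<le> \<Lambda> * (a powr (p - 1) * \<bar>\<eta> k x - \<eta> k y\<bar> / norm (x - y) powr q)"
          unfolding X_def z a_def using elim K_nonneg \<Lambda> z by (intro abs_energy_integrand_le) auto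
        moreover have "0 \<le> W / r * H z" using W(2) r by (simp add: H_def)
        ultimately show ?thesis by (simp add: G_def)
      next
        case False
        \<comment> \<open>One of the points lies off \<open>U\<close>, where both functions vanish.
          Each difference is then a single value up to sign, and \<open>\<eta>_le\<close>
          applies.\<close>
        then have "\<eta> k x = 0 \<and> \<eta>0 x = 0 \<or> \<eta> k y = 0 \<and> \<eta>0 y = 0"
          using \<eta>_out \<eta>0_out by (auto simp: U_def not_less)
        then have "\<bar>\<eta> k x - \<eta> k y\<bar> \<le> W / r * \<bar>\<eta>0 x - \<eta>0 y\<bar>"
          using \<eta>_le[of k x] \<eta>_le[of k y] \<eta>_nonneg[of k x] \<eta>_nonneg[of k y] \<eta>0_nonneg[of x] \<eta>0_nonneg[of y]
          by auto
        then have "\<bar>v x - v y\<bar> powr (p - 2) * \<bar>v x - v y\<bar> * K x y * \<bar>\<eta> k x - \<eta> k y\<bar>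
            \<le> \<bar>v x - v y\<bar> powr (p - 2) * \<bar>v x - v y\<bar> * K x y * (W / r * \<bar>\<eta>0 x - \<eta>0 y\<bar>)"
          using K_nonneg by (intro mult_left_mono) auto
        then have "\<bar>X k z\<bar> \<le> W / r * H z"
          using K_nonneg[of x y] by (simp add: X_def H_def z energy_integrand_def abs_mult ac_simps)
        moreover have "0 \<le> \<Lambda> * (V z + A k z)"
          using \<Lambda> V0 A_nonneg by simp
        ultimately show ?thesis by (simp add: G_def)
      qed
      then show ?case by linarith
    qed
    have \<eta>_lim: "(\<lambda>k. \<eta> k x) \<longlonglongrightarrow> w x" for x
      using avg_tendsto[OF wc[of x] e(1) e_lim] by (simp add: \<eta>_def)
    show "(\<lambda>k. X k z) \<longlonglongrightarrow> energy_integrand p K v w z" for z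
      unfolding X_def energy_integrand_def split_beta by (intro tendsto_intros \<eta>_lim)
    show "(\<lambda>k. G k z) \<longlonglongrightarrow> G' z" for z
    proof -
      have "continuous_on UNIV (\<lambda>t. \<Phi> (z + (t, t)))"
        by (intro continuous_on_compose2[OF \<Phi>(1)] continuous_intros) auto
      from avg_tendsto[OF this e(1) e_lim]
      have "(\<lambda>k. avg (e k) (\<lambda>t. \<Phi> (z + (t, t)))) \<longlonglongrightarrow> \<Phi> z" 
        by (simp add: zero_prod_def[symmetric])
      then show ?thesis unfolding G_def G'_def A_def by (intro tendsto_intros)
    qed
    show "AE z in lebesgue. 0 \<le> energy_integrand p K v w z"
      using AE_lebesgue_pair[OF w_AE w_AE]
    proof eventually_elim
      case (elim z)
      \<comment> \<open>Here \<open>w\<close> is a nondecreasing function of \<open>v\<close>, so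
        the two differences never have opposite signs.\<close>
      have "0 \<le> (v (fst z) - v (snd z)) * (w (fst z) - w (snd z))"
        using elim by (cases "v (fst z) \<le> v (snd z)") (auto simp: zero_le_mult_iff)
      then have "0 \<le> \<bar>v (fst z) - v (snd z)\<bar> powr (p - 2) *
          ((v (fst z) - v (snd z)) * (w (fst z) - w (snd z))) * K (fst z) (snd z)"
        using K_nonneg by simp
      then show ?case by (simp add: energy_integrand_def split_beta mult.assoc)
    qed
  qed

  \<comment> \<open>The closure makes \<open>S\<close> open, and boundedness of \<open>D\<close>
    makes it nonempty. At a suitable point of it, \<open>v x > c > M \<ge> v y\<close>,
    \<open>w x > 0 = w y\<close> and \<open>K x y > 0\<close>, so the energy integrand cannot
    vanish.\<close>
  define S where "S = {x. 0 < w x} \<times> (- closure D)"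
  have "open S"
    unfolding S_def using w by (intro open_Times open_Collect_less) auto
  moreover have "S \<noteq> {}"
  proof -
    have "0 < w x0" using x0 c by (simp add: w_def)
    moreover have "closure D \<noteq> UNIV" using D(2) not_bounded_UNIV compact_imp_bounded by metis
    ultimately show ?thesis by (auto simp: S_def)
  qed
  moreover have "AE z in lebesgue. energy_integrand p K v w z = 0 \<and>
      1 / \<Lambda> \<le> K (fst z) (snd z) * norm (fst z - snd z) powr q \<and>
      (snd z \<notin> D \<longrightarrow> v (snd z) \<le> M)"
    using zero kernel AE_lebesgue_pair[OF out out] by eventually_elim auto
  ultimately have "\<exists>z\<in>S. energy_integrand p K v w z = 0 \<and>
      1 / \<Lambda> \<le> K (fst z) (snd z) * norm (fst z - snd z) powr q \<and>
      (snd z \<notin> D \<longrightarrow> v (snd z) \<le> M)"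
    by (rule AE_lebesgue_open_ex)
  then obtain x y where xy: "(x, y) \<in> S" "energy_integrand p K v w (x, y) = 0"
      "1 / \<Lambda> \<le> K x y * norm (x - y) powr q" "y \<notin> D \<longrightarrow> v y \<le> M"
    by (metis prod.collapse)
  have y: "y \<notin> D" "w y = 0" using xy(1) closure_subset[of D] by (auto simp: S_def w_def)
  have "0 < w x" "c < v x" using xy(1) by (auto simp: S_def w_def split: if_splits)
  moreover have "K x y \<noteq> 0"
    using xy(3) \<Lambda> by auto
  ultimately show False
    using xy(2,4) y c(1) by (simp add: energy_integrand_def)
qed

section \<open>Nonemptiness of the upper class\<close>

theorem lemma18:
  fixes s p \<Lambda> :: real
    and K :: "'a::euclidean_space \<Rightarrow> 'a \<Rightarrow> real"
    and \<Omega> :: "'a set"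
    and g :: "'a \<Rightarrow> ereal"
  assumes "0 < s" and "s < 1" and "1 < p" and "1 \<le> \<Lambda>"
    and "admissible_kernel s p \<Lambda> K"
    and "open \<Omega>"
    and "g \<in> tail_space s p"
    and "\<exists>M::real. AE x in lebesgue. g x \<le> ereal M"
  shows "upper_class s p K \<Omega> g \<noteq> {}"
proof -
  obtain M0 where M0: "AE x in lebesgue. g x \<le> ereal M0" using assms(8) by blast
  define M where "M = max M0 0"
  have M: "0 \<le> M" "AE x in lebesgue. g x \<le> ereal M"
  proof -
    show "AE x in lebesgue. g x \<le> ereal M"
      using M0 by eventually_elim (auto simp: M_def intro: order_trans)
  qed (simp add: M_def)
  define u where "u x = (if x \<in> \<Omega> then ereal M else g x)" for x
  have [measurable]: "g \<in> borel_measurable lebesgue" "\<Omega> \<in> sets lebesgue"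
    using assms(6,7) by (auto simp: tail_space_def)
  have u_meas: "u \<in> borel_measurable lebesgue"
    unfolding u_def by measurable
  \<comment> \<open>Only values in \<Omega> enter, so this holds at every \<open>x\<close>. It gives
    both lower semicontinuity and the boundary condition.\<close>
  have Liminf_u: "ereal M \<le> Liminf (at x within \<Omega>) u" for x
    by (rule Liminf_bounded) (auto simp: u_def eventually_at_filter)
  have comparison: "comparison_principle s p K \<Omega> u"
    unfolding comparison_principle_def
  proof (intro allI impI ballI, elim conjE)
    fix D v x
    assume D: "open D" "D \<Subset> \<Omega>" and v: "weak_solution s p K D v" "continuous_on (closure D) v"
      and front: "\<forall>x\<in>frontier D. ereal (v x) \<le> u x"
      and out: "AE x in lebesgue. x \<notin> D \<longrightarrow> ereal (v x) \<le> u x" and x: "x \<in> D"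
    have D\<Omega>: "closure D \<subseteq> \<Omega>" "compact (closure D)"
      using D(2) by (auto simp: compactly_contained_def)
    have "v x \<le> M"
    proof (rule weak_maximum_principle[OF assms(3) _ assms(4,5) D(1) D\<Omega>(2) _ v(2) _ _ x])
      show "weak_subsolution s p K D v" using v(1) by (simp add: weak_solution_def)
      \<comment> \<open>The frontier of \<open>D\<close> lies in \<Omega>, where \<open>u\<close>
        equals \<open>M\<close>.\<close>
      show "v y \<le> M" if "y \<in> frontier D" for y
        using bspec[OF front that] that D\<Omega>(1) by (auto simp: u_def frontier_def split: if_splits)
      show "AE y in lebesgue. y \<notin> D \<longrightarrow> v y \<le> M"
        using out M(2)
      proof eventually_elim
        case (elim y)
        then have "u y \<le> ereal M" by (simp add: u_def)
        then show ?case using elim(1) order_trans by fastforce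
      qed
    qed (use assms in simp)
    then show "ereal (v x) \<le> u x"
      using x D\<Omega>(1) closure_subset[of D] by (auto simp: u_def)
  qed
  have tail: "(\<lambda>x. max (- u x) 0) \<in> tail_space s p"
  proof -
    let ?f = "\<lambda>x. max (- u x) 0"
    have le: "\<bar>real_of_ereal (?f x)\<bar> powr (p - 1) \<le> \<bar>real_of_ereal (g x)\<bar> powr (p - 1)" for x
    proof (rule powr_mono2)
      show "0 \<le> \<bar>real_of_ereal (?f x)\<bar>" by (rule abs_ge_zero)
      \<comment> \<open>In \<Omega> the left side is 0 as \<open>M \<ge> 0\<close>. Where
        \<open>g\<close> is infinite outside \<Omega>, both sides are 0 by the convention for
        \<open>real_of_ereal\<close>.\<close>
      show "\<bar>real_of_ereal (?f x)\<bar> \<le> \<bar>real_of_ereal (g x)\<bar>"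
        using M(1) by (cases "g x") (auto simp: u_def max_def zero_ereal_def)
    qed (use assms(3) in auto)
    have g: "g \<in> tail_space s p" by fact
    show ?thesis
      unfolding tail_space_def
    proof (intro CollectI conjI allI impI)
      show "?f \<in> borel_measurable lebesgue" using u_meas by measurable
      have "AE x in lebesgue. \<bar>g x\<bar> \<noteq> \<infinity>" using g by (simp add: tail_space_def)
      then show "AE x in lebesgue. \<bar>?f x\<bar> \<noteq> \<infinity>"
        by eventually_elim (auto simp: u_def max_def)
    next
      fix C :: "'a set" assume "compact C"
      have "(\<integral>\<^sup>+x\<in>C. ennreal (\<bar>real_of_ereal (?f x)\<bar> powr (p - 1)) \<partial>lebesgue)
          \<le> (\<integral>\<^sup>+x\<in>C. ennreal (\<bar>real_of_ereal (g x)\<bar> powr (p - 1)) \<partial>lebesgue)"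
        by (intro nn_integral_mono mult_right_mono ennreal_leI le) simp
      also have "\<dots> < \<infinity>" using g \<open>compact C\<close> by (simp add: tail_space_def)
      finally show "(\<integral>\<^sup>+x\<in>C. ennreal (\<bar>real_of_ereal (?f x)\<bar> powr (p - 1)) \<partial>lebesgue) < \<infinity>" .
    next
      have "(\<integral>\<^sup>+x. ennreal (\<bar>real_of_ereal (?f x)\<bar> powr (p - 1) *
            (1 + norm x) powr (- real DIM('a) - s * p)) \<partial>lebesgue)
          \<le> (\<integral>\<^sup>+x. ennreal (\<bar>real_of_ereal (g x)\<bar> powr (p - 1) *
            (1 + norm x) powr (- real DIM('a) - s * p)) \<partial>lebesgue)"
        by (intro nn_integral_mono mult_right_mono ennreal_leI le) simp
      also have "\<dots> < \<infinity>" using g by (simp add: tail_space_def)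
      finally show "(\<integral>\<^sup>+x. ennreal (\<bar>real_of_ereal (?f x)\<bar> powr (p - 1) *
            (1 + norm x) powr (- real DIM('a) - s * p)) \<partial>lebesgue) < \<infinity>" .
    qed
  qed
  have superharmonic: "superharmonic s p K \<Omega> u"
    unfolding superharmonic_def lower_semicontinuous_on_def
    using u_meas comparison tail Liminf_u by (auto simp: u_def)
  have boundary: "ess_lim_sup (- \<Omega>) g x \<le> Liminf (at x within \<Omega>) u" for x
  proof -
    \<comment> \<open>The radius 1 is arbitrary, as \<open>g\<close> is bounded by \<open>M\<close>
      almost everywhere.\<close>
    have "ess_lim_sup (- \<Omega>) g x \<le> esssup (lebesgue_on (ball x 1 \<inter> - \<Omega>)) g"
      unfolding ess_lim_sup_def by (rule INF_lower) simp
    also have "\<dots> \<le> ereal M"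
    proof (rule esssup_I)
      show "g \<in> borel_measurable (lebesgue_on (ball x 1 \<inter> - \<Omega>))"
        by (intro measurable_restrict_space1) simp
      show "AE y in lebesgue_on (ball x 1 \<inter> - \<Omega>). g y \<le> ereal M"
        using M(2) assms(6) by (subst AE_restrict_space_iff) auto
    qed
    also have "\<dots> \<le> Liminf (at x within \<Omega>) u" by (rule Liminf_u)
    finally show ?thesis .
  qed
  have "u \<in> upper_class s p K \<Omega> g"
    unfolding upper_class_def using superharmonic boundary by (auto simp: u_def)
  then show ?thesis by blast
qed

end
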